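(* Let $f\in\mathcal{S}_H$ or $f\in\mathcal{S}$ be a function with integer coefficients. Then $f\in\mathcal{CV}(1)$ (i.e. $f$ is convex in the direction of the real axis) if and only if $f$ is one of the eight functions $$z,\ \frac{z}{1+z},\ \frac{z}{1-z},\ \frac{z}{1+z^2},\ \frac{z}{(1+z)^2},\ \frac{z}{(1-z)^2},\ \frac{z}{1+z+z^2},\ \frac{z}{1-z+z^2},$$ and $f\in\mathcal{CV}(i)$ (i.e. $f$ is convex in the direction of the imaginary axis) if and only if $f$ is one of the four functions $$z,\ \frac{z}{1+z},\ \frac{z}{1-z},\ \frac{z}{1-z^2}.$$
   Context: Let $\mathbb{D}=\{z\in\mathbb{C}:|z|<1\}$. A complex-valued harmonic function on $\mathbb{D}$ can be written $f=h+\overline{g}$ with $h,g$ analytic in $\mathbb{D}$. It is univalent if it is injective on $\mathbb{D}$, and sense-preserving if $J_f(z)=|h'(z)|^2-|g'(z)|^2>0$ for all $z\in\mathbb{D}$. $\mathcal{S}_H$ denotes the class of all univalent sense-preserving harmonic functions $f=h+\overline{g}$ on $\mathbb{D}$ with $h(z)=z+\sum_{n=2}^{\infty}a_nz^n$ and $g(z)=\sum_{n=1}^{\infty}b_nz^n$. $\mathcal{S}$ is the subclass of those $f\in\mathcal{S}_H$ with $g\equiv 0$ (normalized univalent analytic functions). $f$ has integer coefficients if all Taylor coefficients $a_n$ of $h$ and $b_n$ of $g$ are (rational) integers. For $0\le\alpha<\pi$, a domain $D\subset\mathbb{C}$ is convex in the direction $\alpha$ if every line parallel to the line through $0$ and $e^{i\alpha}$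 has a connected (possibly empty) intersection with $D$. A univalent harmonic function $f$ in $\mathbb{D}$ is convex in the direction $\alpha$ if $f(\mathbb{D})$ is convex in the direction $\alpha$. $\mathcal{CV}(1)$ denotes the class of univalent harmonic functions convex in the direction of the real axis ($\alpha=0$), and $\mathcal{CV}(i)$ the class of those convex in the direction of the imaginary axis ($\alpha=\pi/2$). *)

theory Defs
  imports "HOL-Complex_Analysis.Complex_Analysis"
begin

abbreviation unit_disk :: "complex set" ("\<DD>") where
  "\<DD> \<equiv> ball 0 1"

definition harmonic_decomp ::
  "(complex \<Rightarrow> complex) \<Rightarrow> (complex \<Rightarrow> complex) \<Rightarrow> (complex \<Rightarrow> complex) \<Rightarrow> bool" where
  "harmonic_decomp f h g \<longleftrightarrow>
     h holomorphic_on \<DD> \<and> g holomorphic_on \<DD> \<and> (\<forall>z\<in>\<DD>. f z = h z + cnj (g z))"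

text \<open>On the simply connected disk the complex-valued harmonic functions are exactly the sums of
  an analytic and an anti-analytic function; this representation is taken as the definition.\<close>

definition harmonic_on_disk :: "(complex \<Rightarrow> complex) \<Rightarrow> bool" where
  "harmonic_on_disk f \<longleftrightarrow> (\<exists>h g. harmonic_decomp f h g)"

definition taylor_coeff :: "(complex \<Rightarrow> complex) \<Rightarrow> nat \<Rightarrow> complex" where
  "taylor_coeff h n = fps_nth (fps_expansion h 0) n"

definition sense_preserving_pair :: "(complex \<Rightarrow> complex) \<Rightarrow> (complex \<Rightarrow> complex) \<Rightarrow> bool" where
  "sense_preserving_pair h g \<longleftrightarrow> (\<forall>z\<in>\<DD>. (cmod (deriv h z))\<^sup>2 - (cmod (deriv g z))\<^sup>2 > 0)"

text \<open>The constants of \<open>h\<close> and \<open>g\<close> are fixed to be zero, so on the disk the pair is uniquely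
  determined by \<open>f\<close> and the existential quantifiers over pairs below pick out the same
  \<open>h\<close> and \<open>g\<close>.\<close>

definition normalized_decomp ::
  "(complex \<Rightarrow> complex) \<Rightarrow> (complex \<Rightarrow> complex) \<Rightarrow> (complex \<Rightarrow> complex) \<Rightarrow> bool" where
  "normalized_decomp f h g \<longleftrightarrow>
     harmonic_decomp f h g \<and>
     taylor_coeff h 0 = 0 \<and> taylor_coeff h 1 = 1 \<and> taylor_coeff g 0 = 0"

definition S_H :: "(complex \<Rightarrow> complex) set" where
  "S_H = {f. inj_on f \<DD> \<and> (\<exists>h g. normalized_decomp f h g \<and> sense_preserving_pair h g)}"

definition S :: "(complex \<Rightarrow> complex) set" where
  "S = {f \<in> S_H. \<exists>h g. normalized_decomp f h g \<and> (\<forall>z\<in>\<DD>. g z = 0)}"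

definition integer_coefficients :: "(complex \<Rightarrow> complex) \<Rightarrow> bool" where
  "integer_coefficients f \<longleftrightarrow>
     (\<exists>h g. normalized_decomp f h g \<and> (\<forall>n. taylor_coeff h n \<in> \<int> \<and> taylor_coeff g n \<in> \<int>))"

definition convex_in_direction :: "real \<Rightarrow> complex set \<Rightarrow> bool" where
  "convex_in_direction \<alpha> D \<longleftrightarrow>
     (\<forall>w. connected ({w + of_real t * cis \<alpha> | t. t \<in> UNIV} \<inter> D))"

text \<open>The image of a univalent harmonic function is a domain by invariance of domain, so openness
  and connectedness of \<open>f ` \<DD>\<close> need not be required.\<close>

definition CV :: "real \<Rightarrow> (complex \<Rightarrow> complex) set" where
  "CV \<alpha> = {f. harmonic_on_disk f \<and> inj_on f \<DD> \<and> convex_in_direction \<alpha> (f ` \<DD>)}"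

text \<open>Members of the classes matter only through their values on the disk.\<close>

definition one_of_on_disk :: "(complex \<Rightarrow> complex) \<Rightarrow> (complex \<Rightarrow> complex) set \<Rightarrow> bool" where
  "one_of_on_disk f \<F> \<longleftrightarrow> (\<exists>F\<in>\<F>. \<forall>z\<in>\<DD>. f z = F z)"

end

theory Submission
  imports Defs "HOL-Computational_Algebra.Fundamental_Theorem_Algebra"
begin

text \<open>
  The integrality of the coefficients is so restrictive that it first forces \<open>f\<close> to be analytic
  and then leaves only nine functions, whose images of the disk can be written down.

  The co-analytic part \<open>g\<close> vanishes (\<open>coanalytic_part_zero\<close>): the dilatation \<open>g' / h'\<close> is less
  than \<open>1\<close> in modulus, so its coefficients are at most \<open>1\<close> and its constant term is smaller, whereas
  its first non-zero coefficient, say that of \<open>z\<^sup>n\<close>, would be \<open>n + 1\<close> times a non-zero integer.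

  For the remaining analytic univalent function \<open>h\<close>, the quotient \<open>z / h(z)\<close> has integer coefficients
  and is bounded in the disk, because \<open>h\<close> stays away from \<open>0\<close> near the boundary. By Parseval, a
  bounded function with integer coefficients is a polynomial, so \<open>h = z / p\<close>
  (\<open>univalent_reciprocal_polynomial\<close>). Neither \<open>p\<close> nor the numerator \<open>p - z p'\<close> of \<open>h'\<close> has a root in
  the disk. Counting the roots of \<open>p - z p'\<close> with Vieta gives \<open>p = 1 + b z + c z\<^sup>2\<close> with
  \<open>c \<in> {- 1, 0, 1}\<close> (\<open>univalent_reciprocal_degree\<close>), and the sign of \<open>p\<close> at \<open>1\<close> and \<open>- 1\<close> gives
  \<open>\<bar>b\<bar> \<le> 1 + c\<close>. These are Friedman's nine functions (\<open>friedman_theorem\<close>).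

  The image of the disk is the plane with slits in the real axis if \<open>c = 1\<close>, the plane with slits in
  the imaginary axis if \<open>c = - 1\<close>, and a disk or a half-plane if \<open>c = 0\<close>. So it is convex in the real
  direction if and only if \<open>c \<ge> 0\<close>, and in the imaginary direction if and only if \<open>c \<le> 0\<close>
  (\<open>friedman_convex_in_direction\<close>).
\<close>

section \<open>Taylor coefficients on the unit disk\<close>

lemma taylor_coeff_altdef: "taylor_coeff f n = (deriv ^^ n) f 0 / fact n"
  by (simp add: taylor_coeff_def fps_expansion_def)

lemma taylor_sums:
  assumes "f holomorphic_on \<DD>" "z \<in> \<DD>"
  shows "(\<lambda>n. taylor_coeff f n * z ^ n) sums f z"
  using holomorphic_power_series[OF assms] by (simp add: taylor_coeff_altdef)

lemma taylor_coeff_0: "taylor_coeff f 0 = f 0"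
  by (simp add: taylor_coeff_altdef)

lemma holomorphic_imp_fps:
  assumes "f holomorphic_on \<DD>"
  shows "f has_fps_expansion Abs_fps (taylor_coeff f)"
proof -
  have "f has_fps_expansion fps_expansion f 0"
    by (rule has_fps_expansion_fps_expansion[of \<DD>]) (use assms in auto)
  moreover have "Abs_fps (taylor_coeff f) = fps_expansion f 0"
    by (simp add: fps_eq_iff taylor_coeff_def)
  ultimately show ?thesis by simp
qed

lemma taylor_coeff_deriv: "taylor_coeff (deriv f) n = of_nat (Suc n) * taylor_coeff f (Suc n)"
  by (simp add: taylor_coeff_altdef funpow_swap1 fact_Suc del: of_nat_Suc)

lemma taylor_coeff_mult:
  assumes "f holomorphic_on \<DD>" "g holomorphic_on \<DD>"
  shows "taylor_coeff (\<lambda>z. f z * g z) n = (\<Sum>i=0..n. taylor_coeff f i * taylor_coeff g (n - i))"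
proof -
  have "(\<lambda>z. f z * g z) has_fps_expansion Abs_fps (taylor_coeff f) * Abs_fps (taylor_coeff g)"
    using assms by (intro fps_expansion_intros holomorphic_imp_fps)
  from fps_expansion_eqI[OF this] show ?thesis
    by (simp add: taylor_coeff_def[of "\<lambda>z. f z * g z"] fps_mult_nth)
qed

lemma taylor_coeff_cong:
  assumes "\<And>z. z \<in> \<DD> \<Longrightarrow> f z = g z"
  shows "taylor_coeff f n = taylor_coeff g n"
proof -
  have "\<forall>\<^sub>F z in nhds 0. f z = g z"
    using eventually_nhds_in_open[of \<DD> 0] assms by (auto elim!: eventually_mono)
  from higher_deriv_cong_ev[OF this refl] show ?thesis by (simp add: taylor_coeff_altdef)
qed

section \<open>Bounded functions with integer Taylor coefficients\<close>

text \<open>Averaging over the \<open>m\<close>-th roots of unity replaces the integral over a circle in Parseval's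
  formula: for polynomials of degree below \<open>m\<close> the discrete average is already exact, because
  a non-trivial character of the cyclic group of order \<open>m\<close> sums to zero.\<close>

lemma discrete_parseval:
  fixes a :: "nat \<Rightarrow> complex"
  assumes "m > 0"
  shows "(\<Sum>j<m. (cmod (\<Sum>k<m. a k * cis (2 * pi * real j * real k / real m)))\<^sup>2)
         = real m * (\<Sum>k<m. (cmod (a k))\<^sup>2)"
proof -
  define e where "e j k = cis (2 * pi * real j * real k / real m)" for j k :: nat
  have orth: "(\<Sum>j<m. e j k * cnj (e j l)) = (if k = l then of_nat m else 0)"
    if "k < m" "l < m" for k l
  proof -
    define w where "w = cis (2 * pi * (real k - real l) / real m)"
    have pow: "e j k * cnj (e j l) = w ^ j" for j
      by (simp add: e_def w_def cis_cnj cis_mult Complex.DeMoivre diff_divide_distrib algebra_simps)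
    show ?thesis
    proof (cases "k = l")
      case True
      then show ?thesis unfolding pow by (simp add: w_def)
    next
      case False
      have "w \<noteq> 1"
      proof
        assume "w = 1"
        then have "cos (2 * pi * (real k - real l) / real m) = 1"
          by (simp add: w_def complex_eq_iff)
        then obtain n :: int where "2 * pi * (real k - real l) / real m = of_int n * 2 * pi"
          using cos_one_2pi_int by auto
        then have "2 * pi * (real k - real l) = 2 * pi * (of_int n * real m)"
          using assms by (simp add: field_simps)
        then have "real k - real l = of_int n * real m" by simp
        then have eq: "int k - int l = n * int m"
          by (metis of_int_diff of_int_eq_iff of_int_mult of_int_of_nat_eq)
        have "int m dvd int k - int l" unfolding eq by simp
        then have "int m \<le> \<bar>int k - int l\<bar>"
          using False dvd_imp_le_int[of "int k - int l" "int m"] by auto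
        then show False using that by linarith
      qed
      moreover have "w ^ m = 1"
      proof -
        have "w ^ m = cis (2 * pi * (real k - real l))"
          using assms by (simp add: w_def Complex.DeMoivre)
        also have "\<dots> = cis (2 * pi * of_int (int k - int l))" by simp
        also have "\<dots> = 1" by (rule cis_multiple_2pi) simp
        finally show ?thesis .
      qed
      ultimately show ?thesis
        using False unfolding pow by (simp add: geometric_sum)
    qed
  qed
  have "complex_of_real (\<Sum>j<m. (cmod (\<Sum>k<m. a k * e j k))\<^sup>2)
      = (\<Sum>j<m. (\<Sum>k<m. a k * e j k) * cnj (\<Sum>l<m. a l * e j l))"
    by (simp only: of_real_sum complex_norm_square)
  also have "\<dots> = (\<Sum>j<m. \<Sum>k<m. \<Sum>l<m. a k * cnj (a l) * (e j k * cnj (e j l)))"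
    by (simp add: sum_product algebra_simps)
  also have "\<dots> = (\<Sum>k<m. \<Sum>j<m. \<Sum>l<m. a k * cnj (a l) * (e j k * cnj (e j l)))"
    by (rule sum.swap)
  also have "\<dots> = (\<Sum>k<m. \<Sum>l<m. \<Sum>j<m. a k * cnj (a l) * (e j k * cnj (e j l)))"
    by (intro sum.cong refl sum.swap)
  also have "\<dots> = (\<Sum>k<m. \<Sum>l<m. a k * cnj (a l) * (if k = l then of_nat m else 0))"
    by (intro sum.cong refl) (simp only: sum_distrib_left[symmetric] orth lessThan_iff)
  also have "\<dots> = (\<Sum>k<m. a k * cnj (a k) * of_nat m)"
    by (simp add: if_distrib sum.delta cong: if_cong)
  also have "\<dots> = complex_of_real (real m * (\<Sum>k<m. (cmod (a k))\<^sup>2))"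
    by (simp add: complex_norm_square sum_distrib_left mult_ac del: of_real_power)
  finally show ?thesis unfolding e_def of_real_eq_iff .
qed

text \<open>On the circle of radius \<open>r < 1\<close> a long Taylor polynomial of \<open>f\<close> is within \<open>\<epsilon>\<close> of \<open>f\<close>, hence
  bounded by \<open>M + \<epsilon>\<close>, and the discrete Parseval formula turns this into a bound on its
  coefficients. Letting \<open>\<epsilon>\<close> tend to \<open>0\<close> and then \<open>r\<close> to \<open>1\<close> gives the estimate.\<close>

lemma bounded_taylor_coeff_square_sum:
  assumes holo: "f holomorphic_on \<DD>" and bound: "\<And>z. z \<in> \<DD> \<Longrightarrow> cmod (f z) \<le> M"
  shows "(\<Sum>k<N. (cmod (taylor_coeff f k))\<^sup>2) \<le> M\<^sup>2"
proof -
  define c where "c = taylor_coeff f"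
  have M: "M \<ge> 0" using order_trans[OF norm_ge_zero bound[of 0]] by simp
  have main: "(\<Sum>k<N. (cmod (c k))\<^sup>2 * r ^ (2 * k)) \<le> (M + \<epsilon>)\<^sup>2"
    if r: "0 < r" "r < 1" and eps: "\<epsilon> > 0" for r \<epsilon> :: real
  proof -
    obtain r' where r': "r < r'" "r' < 1" using r dense by blast
    have "summable (\<lambda>n. c n * of_real r' ^ n)"
      using taylor_sums[OF holo, of "of_real r'"] r r' by (auto simp: c_def summable_def)
    from powser_insidea[OF this, of "of_real r"]
    have summ: "summable (\<lambda>n. cmod (c n) * r ^ n)"
      using r r' by (simp add: norm_mult norm_power)
    then obtain m0 where m0: "\<And>m. m \<ge> m0 \<Longrightarrow> norm (\<Sum>n. cmod (c (n + m)) * r ^ (n + m)) < \<epsilon>"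
      using suminf_exist_split[OF eps, of "\<lambda>n. cmod (c n) * r ^ n"] by blast
    define m where "m = max (max m0 N) 1"
    have m: "m > 0" "m \<ge> N" "m \<ge> m0" by (auto simp: m_def)
    have part: "cmod (\<Sum>k<m. c k * z ^ k) \<le> M + \<epsilon>" if z: "cmod z = r" for z
    proof -
      have zD: "z \<in> \<DD>" using z r by simp
      have s: "(\<lambda>n. c n * z ^ n) sums f z" using taylor_sums[OF holo zD] by (simp add: c_def)
      have eq: "(\<Sum>k<m. c k * z ^ k) = f z - (\<Sum>n. c (n + m) * z ^ (n + m))"
        using suminf_minus_initial_segment[OF sums_summable[OF s], of m] sums_unique[OF s] by simp
      have "cmod (\<Sum>n. c (n + m) * z ^ (n + m)) \<le> (\<Sum>n. cmod (c (n + m) * z ^ (n + m)))"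
        by (rule summable_norm)
           (use summable_ignore_initial_segment[OF summ, of m] z in \<open>simp add: norm_mult norm_power\<close>)
      also have "\<dots> = (\<Sum>n. cmod (c (n + m)) * r ^ (n + m))"
        by (simp add: norm_mult norm_power z)
      also have "\<dots> < \<epsilon>" using m0[OF m(3)] by simp
      finally have "cmod (\<Sum>n. c (n + m) * z ^ (n + m)) < \<epsilon>" .
      then show ?thesis
        unfolding eq using bound[OF zD] norm_triangle_ineq4[of "f z" "\<Sum>n. c (n + m) * z ^ (n + m)"]
        by linarith
    qed
    have "real m * (\<Sum>k<m. (cmod (c k * of_real r ^ k))\<^sup>2) =
       (\<Sum>j<m. (cmod (\<Sum>k<m. c k * of_real r ^ k * cis (2 * pi * real j * real k / real m)))\<^sup>2)"
      by (rule discrete_parseval[OF m(1), symmetric])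
    also have "\<dots> = (\<Sum>j<m. (cmod (\<Sum>k<m. c k * (of_real r * cis (2 * pi * real j / real m)) ^ k))\<^sup>2)"
      by (simp add: power_mult_distrib Complex.DeMoivre mult_ac)
    also have "\<dots> \<le> (\<Sum>j<m. (M + \<epsilon>)\<^sup>2)"
      using r by (intro sum_mono power_mono part) (auto simp: norm_mult)
    finally have "(\<Sum>k<m. (cmod (c k * of_real r ^ k))\<^sup>2) \<le> (M + \<epsilon>)\<^sup>2"
      using m by simp
    moreover have "(\<Sum>k<N. (cmod (c k * of_real r ^ k))\<^sup>2) \<le> (\<Sum>k<m. (cmod (c k * of_real r ^ k))\<^sup>2)"
      using m by (intro sum_mono2) auto
    ultimately show ?thesis
      using r by (simp add: norm_mult norm_power power_mult_distrib power_even_eq)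
  qed
  have lim: "(\<Sum>k<N. (cmod (c k))\<^sup>2 * r ^ (2 * k)) \<le> M\<^sup>2" if r: "0 < r" "r < 1" for r :: real
  proof (rule tendsto_lowerbound)
    show "((\<lambda>\<epsilon>. (M + \<epsilon>)\<^sup>2) \<longlongrightarrow> M\<^sup>2) (at_right 0)" by (auto intro!: tendsto_eq_intros)
    show "\<forall>\<^sub>F \<epsilon> in at_right 0. (\<Sum>k<N. (cmod (c k))\<^sup>2 * r ^ (2 * k)) \<le> (M + \<epsilon>)\<^sup>2"
      using main[OF r] eventually_at_right_less by (rule eventually_mono[rotated])
  qed auto
  have "(\<Sum>k<N. (cmod (c k))\<^sup>2) \<le> M\<^sup>2"
  proof (rule tendsto_upperbound)
    show "((\<lambda>r. \<Sum>k<N. (cmod (c k))\<^sup>2 * r ^ (2 * k)) \<longlongrightarrow> (\<Sum>k<N. (cmod (c k))\<^sup>2)) (at_left 1)"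
      by (auto intro!: tendsto_eq_intros)
    show "\<forall>\<^sub>F r in at_left 1. (\<Sum>k<N. (cmod (c k))\<^sup>2 * r ^ (2 * k)) \<le> M\<^sup>2"
      using eventually_at_left_real[of 0 1] lim by (auto elim!: eventually_mono)
  qed auto
  then show ?thesis by (simp add: c_def)
qed

text \<open>The squares of the coefficients are summable, so the coefficients tend to zero, and integers
  that tend to zero are eventually zero.\<close>

lemma bounded_integer_taylor_imp_polynomial:
  assumes holo: "f holomorphic_on \<DD>" and bound: "\<And>z. z \<in> \<DD> \<Longrightarrow> cmod (f z) \<le> M"
    and int: "\<And>n. taylor_coeff f n \<in> \<int>"
  obtains p :: "complex poly" where "\<And>n. coeff p n = taylor_coeff f n" "\<And>z. z \<in> \<DD> \<Longrightarrow> f z = poly p z"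
proof -
  define c where "c = taylor_coeff f"
  have "summable (\<lambda>k. (cmod (c k))\<^sup>2)"
    by (rule summableI_nonneg_bounded[of _ "M\<^sup>2"])
       (use bounded_taylor_coeff_square_sum[OF holo bound] in \<open>auto simp: c_def\<close>)
  then have "(\<lambda>k. (cmod (c k))\<^sup>2) \<longlonglongrightarrow> 0" by (rule summable_LIMSEQ_zero)
  then have "\<forall>\<^sub>F k in sequentially. (cmod (c k))\<^sup>2 < 1" by (rule order_tendstoD) simp
  then obtain N where N: "\<And>k. k \<ge> N \<Longrightarrow> (cmod (c k))\<^sup>2 < 1"
    unfolding eventually_sequentially by blast
  have zero: "c k = 0" if "k \<ge> N" for k
  proof -
    obtain i :: int where i: "c k = of_int i" using int[of k] unfolding c_def by (auto elim: Ints_cases)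
    have "\<bar>real_of_int i\<bar> < 1" using N[OF that] by (simp add: i abs_square_less_1)
    then show ?thesis using i by (auto simp flip: of_int_abs)
  qed
  define p where "p = (\<Sum>k<N. monom (c k) k)"
  show thesis
  proof
    show "coeff p n = taylor_coeff f n" for n
      using zero[of n] by (auto simp: p_def coeff_sum c_def)
    fix z :: complex assume z: "z \<in> \<DD>"
    have "(\<lambda>n. c n * z ^ n) sums (\<Sum>k<N. c k * z ^ k)"
      using zero by (intro sums_finite) auto
    with taylor_sums[OF holo z] show "f z = poly p z"
      by (auto simp: c_def p_def poly_sum poly_monom dest: sums_unique2)
  qed
qed

section \<open>The co-analytic part vanishes\<close>

text \<open>Otherwise the image would be open, but no disk fits into the real axis.\<close>

lemma real_valued_holomorphic_constant:
  assumes "f holomorphic_on \<DD>" "\<And>z. z \<in> \<DD> \<Longrightarrow> Im (f z) = 0" "z \<in> \<DD>"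
  shows "f z = f 0"
proof (cases "f constant_on \<DD>")
  case True
  then show ?thesis using assms(3) by (auto simp: constant_on_def)
next
  case False
  have "open (f ` \<DD>)"
    by (rule open_mapping_thm[OF assms(1) _ _ _ _ False]) auto
  moreover have "f 0 \<in> f ` \<DD>" by simp
  ultimately obtain e where e: "e > 0" "ball (f 0) e \<subseteq> f ` \<DD>"
    by (meson open_contains_ball)
  have "f 0 + \<i> * of_real (e / 2) \<in> ball (f 0) e"
    using e by (simp add: dist_norm norm_mult)
  then have "f 0 + \<i> * of_real (e / 2) \<in> f ` \<DD>" using e by blast
  then obtain x where "x \<in> \<DD>" "f x = f 0 + \<i> * of_real (e / 2)" by force
  then have "Im (f 0 + \<i> * of_real (e / 2)) = 0" using assms(2)[of x] by simp
  then show ?thesis using assms(2)[of 0] e by simp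
qed

text \<open>The integrality and the sign condition on the Jacobian speak of possibly different pairs
  \<open>(h, g)\<close>, which are identified here. If \<open>p\<close> and \<open>q\<close> are the differences, then \<open>p\<close> is the
  conjugate of \<open>q\<close> on the disk, so the holomorphic functions \<open>p + q\<close> and \<open>\<i> (p - q)\<close> are
  real-valued, hence constant.\<close>

lemma normalized_decomp_unique:
  assumes "normalized_decomp f h g" "normalized_decomp f h' g'" and z: "z \<in> \<DD>"
  shows "h z = h' z" "g z = g' z"
proof -
  define p q where "p = (\<lambda>z. h z - h' z)" and "q = (\<lambda>z. g' z - g z)"
  have holo: "p holomorphic_on \<DD>" "q holomorphic_on \<DD>"
    using assms unfolding p_def q_def normalized_decomp_def harmonic_decomp_def
    by (auto intro!: holomorphic_intros)
  have pq: "p z = cnj (q z)" if "z \<in> \<DD>" for z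
    using assms that unfolding p_def q_def normalized_decomp_def harmonic_decomp_def
    by (simp add: algebra_simps)
  have p0: "p 0 = 0" "q 0 = 0"
    using assms by (auto simp: p_def q_def normalized_decomp_def taylor_coeff_0)
  have "p z + q z = p 0 + q 0"
    by (rule real_valued_holomorphic_constant[of "\<lambda>z. p z + q z"])
       (use pq holo z in \<open>auto intro!: holomorphic_intros\<close>)
  moreover have "\<i> * (p z - q z) = \<i> * (p 0 - q 0)"
    by (rule real_valued_holomorphic_constant[of "\<lambda>z. \<i> * (p z - q z)"])
       (use pq holo z in \<open>auto intro!: holomorphic_intros\<close>)
  ultimately have "p z = 0" "q z = 0" using p0 by auto
  then show "h z = h' z" "g z = g' z" by (auto simp: p_def q_def)
qed

lemma Ints_cmod_ge_1: "x \<in> \<int> \<Longrightarrow> x \<noteq> 0 \<Longrightarrow> 1 \<le> cmod x"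
  by (auto elim!: Ints_cases simp flip: of_int_abs)

lemma taylor_coeff_bound:
  assumes "f holomorphic_on \<DD>" "\<And>z. z \<in> \<DD> \<Longrightarrow> cmod (f z) \<le> M"
  shows "cmod (taylor_coeff f n) \<le> M"
proof -
  have M: "M \<ge> 0" using order_trans[OF norm_ge_zero assms(2)[of 0]] by simp
  have "(cmod (taylor_coeff f n))\<^sup>2 \<le> (\<Sum>k<Suc n. (cmod (taylor_coeff f k))\<^sup>2)"
    by (rule member_le_sum) auto
  also have "\<dots> \<le> M\<^sup>2" using assms by (rule bounded_taylor_coeff_square_sum)
  finally show ?thesis using M by (rule power2_le_imp_le)
qed

text \<open>The dilatation \<open>w = g' / h'\<close> is bounded by \<open>1\<close>, so all its Taylor coefficients are at most \<open>1\<close> in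
  modulus. Since \<open>h'(0) = 1\<close>, the first non-zero coefficient of \<open>w\<close> agrees with that of \<open>g'\<close>,
  which is a non-zero multiple of \<open>n + 1\<close> if it belongs to \<open>z\<^sup>n\<close>. For \<open>n \<ge> 1\<close> this is too large, and
  for \<open>n = 0\<close> the strict inequality \<open>\<bar>w(0)\<bar> < 1\<close> excludes it.\<close>

lemma coanalytic_part_zero:
  assumes h: "h holomorphic_on \<DD>" and g: "g holomorphic_on \<DD>"
    and sp: "sense_preserving_pair h g"
    and h1: "taylor_coeff h 1 = 1" and g0: "taylor_coeff g 0 = 0"
    and int: "\<And>n. taylor_coeff g n \<in> \<int>" and z: "z \<in> \<DD>"
  shows "g z = 0"
proof -
  define w where "w = (\<lambda>z. deriv g z / deriv h z)"
  have lt: "cmod (deriv g z) < cmod (deriv h z)" if "z \<in> \<DD>" for z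
    using sp that power2_less_imp_less[of "cmod (deriv g z)" "cmod (deriv h z)"]
    by (auto simp: sense_preserving_pair_def)
  then have nz: "deriv h z \<noteq> 0" if "z \<in> \<DD>" for z using that by fastforce
  have holo': "deriv h holomorphic_on \<DD>" "deriv g holomorphic_on \<DD>"
    using h g by (auto intro: holomorphic_deriv)
  have w: "w holomorphic_on \<DD>" unfolding w_def using nz by (intro holomorphic_on_divide holo') auto
  have w1: "cmod (w z) < 1" if "z \<in> \<DD>" for z
    using lt[OF that] nz[OF that] by (simp add: w_def norm_divide)
  have eq: "taylor_coeff w n = of_nat (Suc n) * taylor_coeff g (Suc n)" if "\<And>i. i < n \<Longrightarrow> taylor_coeff w i = 0" for n
  proof -
    have "taylor_coeff (deriv g) n = taylor_coeff (\<lambda>z. w z * deriv h z) n"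
      by (rule taylor_coeff_cong) (use nz in \<open>auto simp: w_def\<close>)
    also have "\<dots> = (\<Sum>i=0..n. taylor_coeff w i * taylor_coeff (deriv h) (n - i))"
      by (rule taylor_coeff_mult) fact+
    also have "\<dots> = (\<Sum>i=0..n. if i = n then taylor_coeff w n else 0)"
      using that h1 by (intro sum.cong refl) (auto simp: taylor_coeff_deriv)
    also have "\<dots> = taylor_coeff w n" by simp
    finally show ?thesis by (simp add: taylor_coeff_deriv)
  qed
  have small: "cmod (taylor_coeff w n) < real (Suc n)" for n
  proof (cases n)
    case 0
    then show ?thesis using w1[of 0] by (simp add: taylor_coeff_0)
  next
    case (Suc m)
    have "cmod (taylor_coeff w n) \<le> 1"
      using w w1 by (intro taylor_coeff_bound) (auto intro: less_imp_le)
    then show ?thesis using Suc by simp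
  qed
  have step: "taylor_coeff g (Suc n) = 0" if "taylor_coeff w n = of_nat (Suc n) * taylor_coeff g (Suc n)" for n
  proof (rule ccontr)
    assume "taylor_coeff g (Suc n) \<noteq> 0"
    then have "1 \<le> cmod (taylor_coeff g (Suc n))" using int Ints_cmod_ge_1 by blast
    then have "real (Suc n) \<le> cmod (taylor_coeff w n)"
      unfolding that norm_mult norm_of_nat by (simp del: of_nat_Suc)
    then show False using small[of n] by simp
  qed
  have wz: "taylor_coeff w n = 0" for n
  proof (induction n rule: less_induct)
    case (less n)
    from eq[OF less.IH] step show ?case by simp
  qed
  have "taylor_coeff g n = 0" for n
    by (cases n) (use g0 step eq wz in auto)
  then have "(\<lambda>n. 0) sums g z" using taylor_sums[OF g z] by simp
  then show ?thesis using sums_unique2 sums_zero by blast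
qed

section \<open>Univalent functions with integer coefficients\<close>

text \<open>By Vieta, the quotient of the two coefficients is up to sign the product of the roots, each
  of which has modulus at least \<open>1\<close>.\<close>

lemma lead_coeff_le_coeff_0:
  fixes p :: "complex poly"
  assumes "\<And>z. z \<in> \<DD> \<Longrightarrow> poly p z \<noteq> 0"
  shows "cmod (lead_coeff p) \<le> cmod (coeff p 0)"
proof -
  have "cmod (coeff p 0) = cmod (poly (smult (lead_coeff p) (\<Prod>z|poly p z = 0. [:-z, 1:] ^ order z p)) 0)"
    by (subst complex_poly_decompose) (simp add: poly_0_coeff_0)
  also have "\<dots> = cmod (lead_coeff p) * (\<Prod>z|poly p z = 0. cmod z ^ order z p)"
    by (simp add: norm_mult poly_prod prod_norm[symmetric] norm_power)
  also have "\<dots> \<ge> cmod (lead_coeff p) * 1"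
    by (intro mult_left_mono prod_ge_1 one_le_power) (use assms in \<open>auto simp: not_less[symmetric]\<close>)
  finally show ?thesis by simp
qed

text \<open>The quadratic is positive at \<open>0\<close>; were it negative at \<open>1\<close> or \<open>- 1\<close>, it would have a real root in
  between.\<close>

lemma quadratic_no_root_in_disk:
  fixes b c :: real
  assumes "\<And>z. z \<in> \<DD> \<Longrightarrow> 1 + of_real b * z + of_real c * z\<^sup>2 \<noteq> 0"
  shows "\<bar>b\<bar> \<le> 1 + c"
proof (rule ccontr)
  assume neg: "\<not> \<bar>b\<bar> \<le> 1 + c"
  \<comment> \<open>\<open>P t\<close> is the quadratic at \<open>- s t\<close>: the sign \<open>s\<close> selects the end point where it is smaller.\<close>
  define s where "s = (if b \<ge> 0 then 1 else -1 :: real)"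
  define P where "P = (\<lambda>t::real. 1 - t * \<bar>b\<bar> + c * t\<^sup>2)"
  have "\<exists>t\<ge>0. t \<le> 1 \<and> P t = 0"
    by (rule IVT2) (use neg in \<open>auto simp: P_def intro!: continuous_intros\<close>)
  then obtain t where t: "0 \<le> t" "t \<le> 1" "P t = 0" by blast
  then have "t \<noteq> 1" using neg by (auto simp: P_def)
  then have "complex_of_real (- s * t) \<in> \<DD>" using t by (auto simp: s_def norm_mult)
  note assms[OF this]
  also have "1 + of_real b * complex_of_real (- s * t) + of_real c * (complex_of_real (- s * t))\<^sup>2
      = complex_of_real (1 + b * (- s * t) + c * (- s * t)\<^sup>2)" by simp
  also have "1 + b * (- s * t) + c * (- s * t)\<^sup>2 = P t"
    by (simp add: P_def s_def abs_if)
  finally show False using t by simp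
qed

text \<open>The coefficients of the reciprocal come from a recursion that divides only by \<open>q 0 = 1\<close>.\<close>

lemma reciprocal_integer_taylor:
  assumes q: "q holomorphic_on \<DD>" and u: "u holomorphic_on \<DD>"
    and inv: "\<And>z. z \<in> \<DD> \<Longrightarrow> u z * q z = 1"
    and q0: "q 0 = 1" and int: "\<And>n. taylor_coeff q n \<in> \<int>"
  shows "taylor_coeff u n \<in> \<int>"
proof (induction n rule: less_induct)
  case (less n)
  have sum: "(\<Sum>i=0..n. taylor_coeff u i * taylor_coeff q (n - i)) = taylor_coeff (\<lambda>z. 1) n"
    using taylor_coeff_cong[of "\<lambda>z. u z * q z" "\<lambda>z. 1", OF inv] taylor_coeff_mult[OF u q] by simp
  have "taylor_coeff (\<lambda>z. 1) n = fps_nth 1 n"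
    unfolding taylor_coeff_def by (subst fps_expansion_eqI[OF has_fps_expansion_1]) simp
  then have "taylor_coeff (\<lambda>z. 1) n \<in> \<int>" by (cases n) auto
  moreover have "(\<Sum>i=0..n. taylor_coeff u i * taylor_coeff q (n - i))
     = (\<Sum>i<n. taylor_coeff u i * taylor_coeff q (n - i)) + taylor_coeff u n"
    using q0 by (simp add: taylor_coeff_0 atLeast0AtMost lessThan_Suc_atMost[symmetric])
  moreover have "(\<Sum>i<n. taylor_coeff u i * taylor_coeff q (n - i)) \<in> \<int>"
    using less int by (intro Ints_sum Ints_mult) auto
  ultimately show ?case using sum by (metis Ints_diff add_diff_cancel_left')
qed

text \<open>The function \<open>u(z) = z / h(z)\<close> extends holomorphically to \<open>0\<close> and has integer coefficients. It is
  also bounded: by injectivity \<open>h\<close> cannot return, for \<open>\<bar>z\<bar> > 1/2\<close>, to the neighbourhood of \<open>0\<close>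
  that it already covers on \<open>\<bar>z\<bar> < 1/2\<close>. A bounded function with integer coefficients is a
  polynomial. This elementary bound takes the place of the area theorem.\<close>

lemma univalent_reciprocal_polynomial:
  assumes h: "h holomorphic_on \<DD>" and inj: "inj_on h \<DD>"
    and h0: "taylor_coeff h 0 = 0" and h1: "taylor_coeff h 1 = 1"
    and int: "\<And>n. taylor_coeff h n \<in> \<int>"
  obtains p :: "complex poly"
  where "coeff p 0 = 1" "\<And>n. coeff p n \<in> \<int>" "\<And>z. z \<in> \<DD> \<Longrightarrow> poly p z \<noteq> 0"
    "\<And>z. z \<in> \<DD> \<Longrightarrow> h z * poly p z = z"
proof -
  define q where "q = (\<lambda>z. if z = 0 then deriv h 0 else (h z - h 0) / (z - 0))"
  have h00: "h 0 = 0" using h0 by (simp add: taylor_coeff_0)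
  have q: "q holomorphic_on \<DD>"
    unfolding q_def by (rule pole_lemma[OF h]) simp
  have q0: "q 0 = 1" using h1 by (simp add: q_def taylor_coeff_altdef)
  have hq: "h z = z * q z" for z by (simp add: q_def h00)
  have hnz: "h z \<noteq> 0" if "z \<in> \<DD>" "z \<noteq> 0" for z
    using inj_onD[OF inj, of z 0] that h00 by auto
  have qnz: "q z \<noteq> 0" if "z \<in> \<DD>" for z
    using hnz[OF that] q0 hq[of z] by (cases "z = 0") auto
  have qint: "taylor_coeff q n \<in> \<int>" for n
  proof -
    have "(\<lambda>z. z * q z) has_fps_expansion fps_X * Abs_fps (taylor_coeff q)"
      by (intro fps_expansion_intros holomorphic_imp_fps q)
    then have "h has_fps_expansion fps_X * Abs_fps (taylor_coeff q)" by (simp flip: hq)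
    from fps_expansion_eqI[OF this] have "taylor_coeff h (Suc n) = taylor_coeff q n"
      by (simp add: taylor_coeff_def[of h])
    then show ?thesis using int[of "Suc n"] by simp
  qed
  define u where "u = (\<lambda>z. 1 / q z)"
  have u: "u holomorphic_on \<DD>"
    unfolding u_def using qnz by (intro holomorphic_on_divide q holomorphic_intros) auto
  have uint: "taylor_coeff u n \<in> \<int>" for n
    by (rule reciprocal_integer_taylor[OF q u _ q0 qint]) (use qnz in \<open>auto simp: u_def\<close>)
  have "\<exists>M. \<forall>z\<in>\<DD>. cmod (u z) \<le> M"
  proof -
    have "compact (u ` cball 0 (1/2))"
      using u by (intro compact_continuous_image holomorphic_on_imp_continuous_on)
         (auto elim: holomorphic_on_subset)
    then obtain B where B: "\<And>z. z \<in> cball 0 (1/2) \<Longrightarrow> cmod (u z) \<le> B"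
      using compact_imp_bounded bounded_iff by (metis imageI)
    have "open (h ` ball 0 (1/2))"
    proof (rule open_mapping_thm[OF h])
      have "h 0 \<noteq> h (1/2)" using inj_onD[OF inj, of 0 "1/2"] by auto
      then show "\<not> h constant_on \<DD>" unfolding constant_on_def by force
    qed auto
    moreover have "0 \<in> h ` ball 0 (1/2)" using h00 by (force intro: image_eqI[of _ _ 0])
    ultimately obtain d where d: "d > 0" "ball 0 d \<subseteq> h ` ball 0 (1/2)"
      by (meson open_contains_ball)
    have far: "cmod (u z) \<le> 1 / d" if z: "z \<in> \<DD>" "z \<notin> cball 0 (1/2)" for z
    proof -
      have "h z \<notin> h ` ball 0 (1/2)"
        using inj_onD[OF inj, of z] z by fastforce
      then have "d \<le> cmod (h z)" using d by (force simp: not_less[symmetric])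
      moreover have "u z = z / h z" using z by (auto simp: u_def q_def h00)
      ultimately show ?thesis using z d by (auto simp: norm_divide intro!: frac_le)
    qed
    have "cmod (u z) \<le> max B (1 / d)" if "z \<in> \<DD>" for z
      using B[of z] far[OF that] by (cases "z \<in> cball 0 (1/2)") (auto simp: le_max_iff_disj)
    then show ?thesis by blast
  qed
  then obtain M where M: "\<And>z. z \<in> \<DD> \<Longrightarrow> cmod (u z) \<le> M" by blast
  obtain p where p: "\<And>n. coeff p n = taylor_coeff u n" "\<And>z. z \<in> \<DD> \<Longrightarrow> u z = poly p z"
    using bounded_integer_taylor_imp_polynomial[OF u M uint] by blast
  show thesis
  proof
    show "coeff p 0 = 1" using p q0 by (simp add: taylor_coeff_0 u_def)
    show "coeff p n \<in> \<int>" for n using p uint by simp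
    show "poly p z \<noteq> 0" "h z * poly p z = z" if "z \<in> \<DD>" for z
      using p(2)[OF that, symmetric] qnz[OF that] hq[of z] by (auto simp: u_def)
  qed
qed

text \<open>For \<open>h = z / p\<close> one has \<open>h' = (p - z p') / p\<^sup>2\<close>, and \<open>h'\<close> has no zeros because \<open>h\<close> is injective. Thus
  \<open>p - z p'\<close>, whose coefficients are \<open>(1 - n) p\<^sub>n\<close>, has no root in the disk, and its leading
  coefficient is at most \<open>1\<close> in modulus. If \<open>d \<ge> 2\<close> is the degree of \<open>p\<close>, this says
  \<open>(d - 1) \<bar>p\<^sub>d\<bar> \<le> 1\<close>, and as \<open>p\<^sub>d\<close> is a non-zero integer, \<open>d = 2\<close>.\<close>

lemma univalent_reciprocal_degree:
  fixes p :: "complex poly"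
  assumes h: "h holomorphic_on \<DD>" and inj: "inj_on h \<DD>"
    and p0: "coeff p 0 = 1" and nz: "\<And>z. z \<in> \<DD> \<Longrightarrow> poly p z \<noteq> 0"
    and hp: "\<And>z. z \<in> \<DD> \<Longrightarrow> h z * poly p z = z"
    and int: "\<And>n. coeff p n \<in> \<int>"
  shows "degree p \<le> 2" "cmod (coeff p 2) \<le> 1"
proof -
  define Q where "Q = p - pCons 0 (pderiv p)"
  have coeffQ: "coeff Q n = (1 - of_nat n) * coeff p n" for n
    by (cases n) (simp_all add: Q_def coeff_pderiv algebra_simps)
  have Qnz: "poly Q z \<noteq> 0" if z: "z \<in> \<DD>" for z
  proof
    assume "poly Q z = 0"
    then have eq: "poly p z = z * poly (pderiv p) z" by (simp add: Q_def)
    have dh: "(h has_field_derivative deriv h z) (at z)"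
      using h z by (simp add: holomorphic_derivI)
    have "((\<lambda>z. h z * poly p z) has_field_derivative (deriv h z * poly p z + h z * poly (pderiv p) z)) (at z)"
      by (auto intro!: derivative_eq_intros dh)
    moreover have "((\<lambda>z. h z * poly p z) has_field_derivative 1) (at z)"
      by (rule has_field_derivative_transform_within_open[of "\<lambda>z. z" _ _ \<DD>])
         (use z hp in \<open>auto intro: derivative_eq_intros\<close>)
    ultimately have "deriv h z * poly p z + h z * poly (pderiv p) z = 1"
      by (rule DERIV_unique)
    moreover have "h z * poly (pderiv p) z = 1"
    proof -
      have "(h z * poly (pderiv p) z) * poly p z = (h z * poly p z) * poly (pderiv p) z"
        by (simp only: mult_ac)
      also have "\<dots> = poly p z" using hp[OF z] eq by simp
      finally have "(h z * poly (pderiv p) z) * poly p z = poly p z" .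
      then show ?thesis using nz[OF z] by simp
    qed
    moreover have "deriv h z \<noteq> 0"
      using holomorphic_injective_imp_regular[OF h _ inj z] by simp
    ultimately show False using nz[OF z] by simp
  qed
  have bound: "(real (degree p) - 1) * cmod (coeff p (degree p)) \<le> 1" if "degree p \<ge> 2"
  proof -
    have "coeff Q (degree p) \<noteq> 0"
      using that coeffQ[of "degree p"] by (auto simp: leading_coeff_0_iff)
    moreover have "coeff Q i = 0" if "i > degree p" for i
      using that coeffQ[of i] by (simp add: coeff_eq_0)
    ultimately have "degree Q = degree p"
      by (meson le_antisym le_degree degree_le not_le)
    then have "cmod (coeff Q (degree p)) \<le> cmod (coeff Q 0)"
      using lead_coeff_le_coeff_0[OF Qnz] by simp
    then have "cmod (1 - of_nat (degree p)) * cmod (coeff p (degree p)) \<le> 1"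
      unfolding coeffQ by (simp add: norm_mult p0)
    moreover have "cmod (1 - of_nat (degree p)) = real (degree p) - 1"
    proof -
      have "1 - complex_of_nat (degree p) = of_real (1 - real (degree p))" by simp
      then have "cmod (1 - of_nat (degree p)) = \<bar>1 - real (degree p)\<bar>" by (metis norm_of_real)
      then show ?thesis using that by simp
    qed
    ultimately show ?thesis by simp
  qed
  show deg: "degree p \<le> 2"
  proof (rule ccontr)
    assume d: "\<not> degree p \<le> 2"
    then have "coeff p (degree p) \<noteq> 0" by (auto simp: leading_coeff_0_iff)
    then have "1 \<le> cmod (coeff p (degree p))" using int Ints_cmod_ge_1 by blast
    then have "(real (degree p) - 1) * 1 \<le> (real (degree p) - 1) * cmod (coeff p (degree p))"
      using d by (intro mult_left_mono) auto
    moreover have "(real (degree p) - 1) * cmod (coeff p (degree p)) \<le> 1"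
      using d by (intro bound) simp
    ultimately have "(real (degree p) - 1) * 1 \<le> 1" by (blast intro: order_trans)
    then show False using d by simp
  qed
  show "cmod (coeff p 2) \<le> 1"
  proof (cases "degree p = 2")
    case True
    then show ?thesis using bound by simp
  next
    case False
    then show ?thesis using deg by (simp add: coeff_eq_0)
  qed
qed

definition quad_recip :: "real \<Rightarrow> real \<Rightarrow> complex \<Rightarrow> complex" where
  "quad_recip b c z = z / (1 + of_real b * z + of_real c * z\<^sup>2)"

definition friedman_pair :: "int \<Rightarrow> int \<Rightarrow> bool" where
  "friedman_pair b c \<longleftrightarrow> \<bar>c\<bar> \<le> 1 \<and> \<bar>b\<bar> \<le> 1 + c"

text \<open>Friedman's theorem. The nine pairs \<open>(b, c)\<close> allowed by \<open>friedman_pair\<close> give the nine univalent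
  functions with integer coefficients.\<close>

theorem friedman_theorem:
  assumes h: "h holomorphic_on \<DD>" and inj: "inj_on h \<DD>"
    and h0: "taylor_coeff h 0 = 0" and h1: "taylor_coeff h 1 = 1"
    and int: "\<And>n. taylor_coeff h n \<in> \<int>"
  obtains b c where "friedman_pair b c" "\<And>z. z \<in> \<DD> \<Longrightarrow> h z = quad_recip (of_int b) (of_int c) z"
proof -
  obtain p :: "complex poly" where p: "coeff p 0 = 1" "\<And>n. coeff p n \<in> \<int>"
    "\<And>z. z \<in> \<DD> \<Longrightarrow> poly p z \<noteq> 0" "\<And>z. z \<in> \<DD> \<Longrightarrow> h z * poly p z = z"
    using univalent_reciprocal_polynomial[OF assms] by blast
  note deg = univalent_reciprocal_degree[OF h inj p(1) p(3) p(4) p(2)]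
  obtain b c :: int where bc: "coeff p 1 = of_int b" "coeff p 2 = of_int c"
    using p(2) by (meson Ints_cases)
  have pz: "poly p z = 1 + of_real (of_int b) * z + of_real (of_int c) * z\<^sup>2" for z
  proof -
    have "poly (\<Sum>i\<le>2. monom (coeff p i) i) z = (\<Sum>i\<le>2. coeff p i * z ^ i)"
      unfolding poly_sum poly_monom ..
    then have "poly p z = (\<Sum>i\<le>2. coeff p i * z ^ i)"
      by (simp only: poly_as_sum_of_monoms'[OF deg(1)])
    also have "\<dots> = coeff p 0 + coeff p 1 * z + coeff p 2 * z\<^sup>2"
      by (simp add: numeral_2_eq_2)
    finally show ?thesis using p(1) bc by simp
  qed
  have "\<bar>real_of_int b\<bar> \<le> 1 + real_of_int c"
    by (rule quadratic_no_root_in_disk) (use p(3) pz in metis)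
  moreover have "\<bar>real_of_int c\<bar> \<le> 1" using deg(2) by (simp add: bc)
  ultimately have "friedman_pair b c" unfolding friedman_pair_def by linarith
  moreover have "h z = quad_recip (of_int b) (of_int c) z" if "z \<in> \<DD>" for z
    using p(3)[OF that] p(4)[OF that] unfolding quad_recip_def pz by (simp add: field_simps)
  ultimately show thesis using that by blast
qed

section \<open>Images of the disk and directional convexity\<close>

lemma convex_line: "convex {w + of_real t * d | t::real. t \<in> UNIV}" for w d :: complex
proof (rule convexI)
  fix x y :: complex and u v :: real
  assume "x \<in> {w + of_real t * d | t::real. t \<in> UNIV}" "y \<in> {w + of_real t * d | t::real. t \<in> UNIV}"
    and uv: "u + v = 1"
  then obtain s t where "x = w + of_real s * d" "y = w + of_real t * d" by auto
  then have "u *\<^sub>R x + v *\<^sub>R y = of_real (u + v) * w + of_real (u * s + v * t) * d"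
    by (simp add: scaleR_conv_of_real algebra_simps)
  then have "u *\<^sub>R x + v *\<^sub>R y = w + of_real (u * s + v * t) * d" using uv by simp
  then show "u *\<^sub>R x + v *\<^sub>R y \<in> {w + of_real t * d | t::real. t \<in> UNIV}" by blast
qed

lemma convex_imp_convex_in_direction: "convex D \<Longrightarrow> convex_in_direction \<alpha> D"
  unfolding convex_in_direction_def by (intro allI convex_connected convex_Int convex_line)

lemma not_convex_in_direction:
  assumes "w + of_real s * cis \<alpha> \<in> D" "w + of_real t * cis \<alpha> \<in> D"
    and "s \<le> 0" "0 \<le> t" and "w \<notin> D"
  shows "\<not> convex_in_direction \<alpha> D"
proof
  let ?L = "{w + of_real t * cis \<alpha> | t. t \<in> UNIV}"
  assume "convex_in_direction \<alpha> D"
  then have conn: "connected (?L \<inter> D)" by (simp add: convex_in_direction_def)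
  \<comment> \<open>\<open>\<phi>\<close> is the coordinate along the line, which reduces the claim to intervals.\<close>
  define \<phi> where "\<phi> z = Re ((z - w) * cnj (cis \<alpha>))" for z
  have phi: "\<phi> (w + of_real t * cis \<alpha>) = t" for t
    by (simp add: \<phi>_def mult.assoc cis_cnj cis_mult)
  have "connected (\<phi> ` (?L \<inter> D))"
    unfolding \<phi>_def by (rule connected_continuous_image[OF _ conn]) (intro continuous_intros)
  moreover have "s \<in> \<phi> ` (?L \<inter> D)" "t \<in> \<phi> ` (?L \<inter> D)"
    using assms(1,2) phi by (force intro: image_eqI[of _ _ "w + of_real _ * cis \<alpha>"])+
  ultimately have "0 \<in> \<phi> ` (?L \<inter> D)"
    using connected_contains_Icc assms(3,4) by fastforce
  then show False using phi assms(5) by auto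
qed

text \<open>If \<open>w\<close> is the image of \<open>z \<noteq> 0\<close>, then \<open>1/w - b = z + 1/z\<close>. The Joukowski map \<open>z + 1/z\<close> sends the
  punctured disk onto the complement of the segment \<open>[-2, 2]\<close>, so the image is the plane slit
  along the real \<open>w\<close> with \<open>1/w\<close> in \<open>[b - 2, b + 2]\<close>. In the form below the two linear conditions cut
  out an interval around \<open>0\<close> on the real axis.\<close>

lemma image_quad_recip_1:
  fixes b :: real
  assumes b: "\<bar>b\<bar> \<le> 2"
  shows "quad_recip b 1 ` \<DD> = {w. Im w \<noteq> 0 \<or> ((2 + b) * Re w < 1 \<and> (b - 2) * Re w < 1)}"
    (is "_ = ?R")
proof (intro equalityI subsetI)
  fix w assume "w \<in> quad_recip b 1 ` \<DD>"
  then obtain z where z: "cmod z < 1" and w: "w = quad_recip b 1 z" by auto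
  show "w \<in> ?R"
  proof (cases "w = 0 \<or> Im w \<noteq> 0")
    case False
    then have w0: "w \<noteq> 0" and im: "Im w = 0" by auto
    then have z0: "z \<noteq> 0" and P0: "1 + b * z + z\<^sup>2 \<noteq> 0" using w by (auto simp: quad_recip_def)
    have "inverse w - of_real b = z + inverse z"
      using z0 P0 by (simp add: w quad_recip_def field_simps power2_eq_square)
    then have "Im (z + inverse z) = Im (inverse w)" by (simp add: complex_eq_iff)
    then have "Im z * (1 - 1 / (cmod z)\<^sup>2) = 0"
      using im by (simp add: cmod_power2 right_diff_distrib)
    moreover have "(cmod z)\<^sup>2 < 1" using z by (simp add: abs_square_less_1)
    then have "1 - 1 / (cmod z)\<^sup>2 \<noteq> 0" using z0 by (simp add: field_simps)
    ultimately have "Im z = 0" using z0 by simp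
    then obtain x where x: "z = of_real x" by (metis complex_is_Real_iff Reals_cases)
    have x1: "\<bar>x\<bar> < 1" using z by (simp add: x)
    define P where "P = 1 + b * x + x\<^sup>2"
    have "\<bar>b * x\<bar> \<le> 2 * \<bar>x\<bar>" unfolding abs_mult using b by (intro mult_right_mono) auto
    moreover have "2 * \<bar>x\<bar> < 1 + x\<^sup>2"
    proof -
      have "0 < (1 - \<bar>x\<bar>)\<^sup>2" using x1 by simp
      then show ?thesis by (simp add: power2_diff)
    qed
    ultimately have P: "P > 0" unfolding P_def by linarith
    have wx: "w = of_real (x / P)" by (simp add: w x quad_recip_def P_def)
    have "1 - (2 + b) * (x / P) = (1 - x)\<^sup>2 / P" "1 - (b - 2) * (x / P) = (1 + x)\<^sup>2 / P"
      using P by (simp_all add: field_simps) (simp_all add: P_def power2_eq_square algebra_simps)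
    moreover have "(1 - x)\<^sup>2 / P > 0" "(1 + x)\<^sup>2 / P > 0" using P x1 by auto
    ultimately have "(2 + b) * (x / P) < 1" "(b - 2) * (x / P) < 1" by linarith+
    then show ?thesis by (simp add: wx)
  qed auto
next
  fix w assume R: "w \<in> ?R"
  show "w \<in> quad_recip b 1 ` \<DD>"
  proof (cases "w = 0")
    case True
    then show ?thesis by (force simp: quad_recip_def intro: image_eqI[of _ _ 0])
  next
    case w0: False
    define s where "s = inverse w - of_real b"
    \<comment> \<open>The roots of \<open>y\<^sup>2 - s y + 1\<close> are \<open>y\<close> and \<open>1/y\<close>; one lies in the disk unless both lie on the circle.\<close>
    define y where "y = (s + csqrt (s\<^sup>2 - 4)) / 2"
    have "2 * y - s = csqrt (s\<^sup>2 - 4)" by (simp add: y_def field_simps)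
    then have "(2 * y - s)\<^sup>2 = s\<^sup>2 - 4" by simp
    then have "4 * (y\<^sup>2 + 1) = 4 * (s * y)" by (simp add: power2_eq_square algebra_simps)
    then have y: "y\<^sup>2 + 1 = s * y" by (simp only: mult_cancel_left) simp
    then have y0: "y \<noteq> 0" by auto
    have ys: "y + inverse y = s" using y y0 by (simp add: field_simps power2_eq_square)
    have "cmod y \<noteq> 1"
    proof
      assume y1: "cmod y = 1"
      have "inverse y = cnj y"
        using y1 complex_norm_square[of y] by (intro inverse_unique) simp
      then have s: "s = of_real (2 * Re y)" using ys by (simp add: complex_add_cnj)
      have "\<bar>Re y\<bar> \<le> 1" using abs_Re_le_cmod[of y] y1 by simp
      then have re: "Re y \<le> 1" "- 1 \<le> Re y" by auto
      define x where "x = 2 * Re y + b"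
      have "inverse w = of_real x" using s by (simp add: s_def x_def algebra_simps)
      then have wx: "w = of_real (1 / x)" and x0: "x \<noteq> 0"
        using w0 by (auto simp: divide_inverse simp flip: of_real_inverse) (metis inverse_inverse_eq of_real_inverse)
      then have "(2 + b) * (1 / x) < 1" "(b - 2) * (1 / x) < 1" using R by auto
      then show False
        using x0 re by (cases "x > 0") (auto simp: field_simps x_def)
    qed
    then obtain z where z: "cmod z < 1" "z \<noteq> 0" "z + inverse z = s"
    proof (cases "cmod y < 1")
      case True
      then show ?thesis using that y0 ys by blast
    next
      case False
      with \<open>cmod y \<noteq> 1\<close> have "cmod (inverse y) < 1" by (simp add: norm_inverse inverse_less_1_iff)
      then show ?thesis using that[of "inverse y"] y0 ys by (simp add: add.commute)
    qed
    have P: "1 + of_real b * z + z\<^sup>2 = z * inverse w"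
      using z by (simp add: s_def field_simps power2_eq_square)
    have "quad_recip b 1 z = z / (z * inverse w)" by (simp add: quad_recip_def flip: P)
    also have "\<dots> = w" using z by (simp add: divide_simps)
    finally have "w = quad_recip b 1 z" ..
    then show ?thesis using z by auto
  qed
qed

lemma cis_half_pi: "cis (pi / 2) = \<i>"
  by (simp add: complex_eq_iff)

lemma quad_recip_1_horizontal:
  assumes "\<bar>b\<bar> \<le> 2"
  shows "convex_in_direction 0 (quad_recip b 1 ` \<DD>)"
  unfolding convex_in_direction_def
proof
  fix w
  let ?L = "{w + of_real t * cis 0 | t. t \<in> UNIV}"
  note image = image_quad_recip_1[OF assms]
  show "connected (?L \<inter> quad_recip b 1 ` \<DD>)"
  proof (cases "Im w = 0")
    case False
    then have "?L \<inter> quad_recip b 1 ` \<DD> = ?L" unfolding image by auto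
    then show ?thesis by (simp only: convex_connected convex_line)
  next
    case True
    have "?L \<inter> quad_recip b 1 ` \<DD> = ?L \<inter> {w. (2 + b) * Re w < 1} \<inter> {w. (b - 2) * Re w < 1}"
      unfolding image using True by auto
    moreover have "convex {w. a * Re w < 1}" for a
      using convex_halfspace_lt[of "complex_of_real a" 1]
      by (simp only: inner_complex_def Re_complex_of_real Im_complex_of_real mult_zero_left add_0_right)
    ultimately show ?thesis by (simp only: convex_connected convex_line convex_Int)
  qed
qed

text \<open>Any end point \<open>x\<close> of a slit is missed, while \<open>x + \<i>\<close> and \<open>x - \<i>\<close> are attained.\<close>

lemma quad_recip_1_not_vertical:
  assumes "\<bar>b\<bar> \<le> 2"
  shows "\<not> convex_in_direction (pi / 2) (quad_recip b 1 ` \<DD>)"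
proof -
  obtain x where x: "\<not> ((2 + b) * x < 1 \<and> (b - 2) * x < 1)"
  proof (cases "b = - 2")
    case True
    \<comment> \<open>The Koebe function: its only slit is the negative half-line that ends at \<open>- 1/4\<close>.\<close>
    then show ?thesis using that[of "- 1 / 4"] by simp
  next
    case False
    then have "(2 + b) * (1 / (2 + b)) = 1" using assms by simp
    then show ?thesis using that[of "1 / (2 + b)"] by simp
  qed
  show ?thesis
    unfolding image_quad_recip_1[OF assms]
    by (rule not_convex_in_direction[of "of_real x" "- 1" _ _ 1]) (use x in \<open>auto simp: cis_half_pi\<close>)
qed

text \<open>Substituting \<open>\<i> z\<close> for \<open>z\<close> turns \<open>z / (1 - z\<^sup>2)\<close> into \<open>\<i>\<close> times \<open>z / (1 + z\<^sup>2)\<close>, so the slits are those of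
  the latter function, rotated onto the imaginary axis.\<close>

lemma image_quad_recip_minus_1:
  "quad_recip 0 (- 1) ` \<DD> = {w. Re w \<noteq> 0 \<or> \<bar>Im w\<bar> < 1 / 2}"
proof -
  have rot: "\<DD> = (\<lambda>z. \<i> * z) ` \<DD>"
  proof (intro equalityI subsetI)
    fix z :: complex assume "z \<in> \<DD>"
    then show "z \<in> (\<lambda>z. \<i> * z) ` \<DD>" by (intro image_eqI[of _ _ "- \<i> * z"]) (auto simp: norm_mult)
  qed (auto simp: norm_mult)
  have "quad_recip 0 (- 1) (\<i> * z) = \<i> * quad_recip 0 1 z" for z
    by (simp add: quad_recip_def power_mult_distrib)
  then have "quad_recip 0 (- 1) ` \<DD> = (\<lambda>w. \<i> * w) ` (quad_recip 0 1 ` \<DD>)"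
    by (subst rot) (simp add: image_image)
  also have "\<dots> = (\<lambda>w. \<i> * w) ` {w. Im w \<noteq> 0 \<or> \<bar>Re w\<bar> < 1 / 2}"
    by (subst image_quad_recip_1) (auto simp: abs_less_iff)
  also have "\<dots> = {w. Re w \<noteq> 0 \<or> \<bar>Im w\<bar> < 1 / 2}"
  proof (intro equalityI subsetI)
    fix w assume "w \<in> {w. Re w \<noteq> 0 \<or> \<bar>Im w\<bar> < 1 / 2}"
    then show "w \<in> (\<lambda>w. \<i> * w) ` {w. Im w \<noteq> 0 \<or> \<bar>Re w\<bar> < 1 / 2}"
      by (intro image_eqI[of _ _ "- \<i> * w"]) auto
  qed auto
  finally show ?thesis .
qed

lemma quad_recip_minus_1_vertical: "convex_in_direction (pi / 2) (quad_recip 0 (- 1) ` \<DD>)"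
  unfolding convex_in_direction_def
proof
  fix w
  let ?L = "{w + of_real t * cis (pi / 2) | t. t \<in> UNIV}"
  note image = image_quad_recip_minus_1
  show "connected (?L \<inter> quad_recip 0 (- 1) ` \<DD>)"
  proof (cases "Re w = 0")
    case False
    then have "?L \<inter> quad_recip 0 (- 1) ` \<DD> = ?L" unfolding image by (auto simp: cis_half_pi)
    then show ?thesis by (simp only: convex_connected convex_line)
  next
    case True
    define L where "L = ?L"
    have L: "Re u = 0" if "u \<in> L" for u using that True by (auto simp: L_def cis_half_pi)
    have abs: "\<bar>Im u\<bar> < 1 / 2 \<longleftrightarrow> Im u < 1 / 2 \<and> - (1 / 2) < Im u" for u by linarith
    have "L \<inter> quad_recip 0 (- 1) ` \<DD> = L \<inter> {w. Im w < 1 / 2} \<inter> {w. - (1 / 2) < Im w}"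
      unfolding image abs using L by blast
    moreover have "convex L" unfolding L_def by (rule convex_line)
    ultimately have "connected (L \<inter> quad_recip 0 (- 1) ` \<DD>)"
      by (simp only: convex_connected convex_Int convex_halfspace_Im_lt convex_halfspace_Im_gt)
    then show ?thesis unfolding L_def .
  qed
qed

lemma quad_recip_minus_1_not_horizontal: "\<not> convex_in_direction 0 (quad_recip 0 (- 1) ` \<DD>)"
  unfolding image_quad_recip_minus_1
  by (rule not_convex_in_direction[of "\<i>" "- 1" _ _ 1]) auto

text \<open>The inverse of the Moebius map is \<open>w / (1 - b w)\<close>.\<close>

lemma image_quad_recip_0:
  assumes "\<bar>b\<bar> \<le> 1"
  shows "quad_recip b 0 ` \<DD> = {w. cmod w < cmod (1 - of_real b * w)}"
proof (intro equalityI subsetI)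
  fix w assume "w \<in> quad_recip b 0 ` \<DD>"
  then obtain z where z: "cmod z < 1" and w: "w = z / (1 + of_real b * z)"
    by (auto simp: quad_recip_def)
  have "cmod (of_real b * z) < 1"
    using assms z mult_right_mono[OF assms, of "cmod z"] by (simp add: norm_mult)
  then have nz: "1 + of_real b * z \<noteq> 0"
    by (metis add_eq_0_iff norm_minus_cancel norm_one less_irrefl)
  then have "1 - of_real b * w = 1 / (1 + of_real b * z)" by (simp add: w field_simps)
  then show "w \<in> {w. cmod w < cmod (1 - of_real b * w)}"
    using z nz by (simp add: w norm_divide divide_strict_right_mono)
next
  fix w assume "w \<in> {w. cmod w < cmod (1 - of_real b * w)}"
  then have lt: "cmod w < cmod (1 - of_real b * w)" by simp
  then have nz: "1 - of_real b * w \<noteq> 0" by auto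
  define z where "z = w / (1 - of_real b * w)"
  have "cmod z < 1" using lt nz by (simp add: z_def norm_divide)
  moreover have "1 + of_real b * z = 1 / (1 - of_real b * w)" using nz by (simp add: z_def field_simps)
  then have "w = quad_recip b 0 z" using nz by (simp add: quad_recip_def z_def)
  ultimately show "w \<in> quad_recip b 0 ` \<DD>" by auto
qed

text \<open>The image is a disk for \<open>b = 0\<close> and a half-plane, bounded by a perpendicular bisector, for \<open>b = 1\<close>
  and \<open>b = - 1\<close>.\<close>

lemma quad_recip_0_convex:
  assumes "b \<in> {- 1, 0, 1}"
  shows "convex (quad_recip b 0 ` \<DD>)"
proof -
  have "\<bar>b\<bar> \<le> 1" using assms by auto
  note image = image_quad_recip_0[OF this]
  have sq: "cmod w < cmod v \<longleftrightarrow> (Re w)\<^sup>2 + (Im w)\<^sup>2 < (Re v)\<^sup>2 + (Im v)\<^sup>2" for w v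
    by (simp add: cmod_def)
  consider "b = 0" | "b = 1" | "b = - 1" using assms by auto
  then show ?thesis
  proof cases
    case 1
    then have "quad_recip b 0 ` \<DD> = \<DD>" unfolding image by auto
    then show ?thesis by simp
  next
    case 2
    then have "quad_recip b 0 ` \<DD> = {w. Re w < 1 / 2}"
      unfolding image sq by (auto simp: power2_eq_square algebra_simps)
    then show ?thesis by (simp only: convex_halfspace_Re_lt)
  next
    case 3
    then have "quad_recip b 0 ` \<DD> = {w. - (1 / 2) < Re w}"
      unfolding image sq by (auto simp: power2_eq_square algebra_simps)
    then show ?thesis by (simp only: convex_halfspace_Re_gt)
  qed
qed

text \<open>The sign of \<open>c\<close> decides: real slits for \<open>c = 1\<close>, imaginary slits for \<open>c = - 1\<close>, a convex image for
  \<open>c = 0\<close>.\<close>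

lemma friedman_convex_in_direction:
  assumes "friedman_pair b c"
  shows "convex_in_direction 0 (quad_recip (of_int b) (of_int c) ` \<DD>) \<longleftrightarrow> c \<ge> 0"
    and "convex_in_direction (pi / 2) (quad_recip (of_int b) (of_int c) ` \<DD>) \<longleftrightarrow> c \<le> 0"
proof -
  consider "c = 1" "\<bar>b\<bar> \<le> 2" | "c = 0" "b \<in> {- 1, 0, 1}" | "c = - 1" "b = 0"
    using assms unfolding friedman_pair_def by fastforce
  then have "(convex_in_direction 0 (quad_recip (of_int b) (of_int c) ` \<DD>) \<longleftrightarrow> c \<ge> 0) \<and>
    (convex_in_direction (pi / 2) (quad_recip (of_int b) (of_int c) ` \<DD>) \<longleftrightarrow> c \<le> 0)"
  proof cases
    case 1
    then have "\<bar>real_of_int b\<bar> \<le> 2" by linarith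
    with 1 show ?thesis by (simp add: quad_recip_1_horizontal quad_recip_1_not_vertical)
  next
    case 2
    then have "convex (quad_recip (of_int b) 0 ` \<DD>)" by (intro quad_recip_0_convex) auto
    with 2 show ?thesis by (simp add: convex_imp_convex_in_direction)
  next
    case 3
    then show ?thesis
      using quad_recip_minus_1_vertical quad_recip_minus_1_not_horizontal by simp
  qed
  then show "convex_in_direction 0 (quad_recip (of_int b) (of_int c) ` \<DD>) \<longleftrightarrow> c \<ge> 0"
    "convex_in_direction (pi / 2) (quad_recip (of_int b) (of_int c) ` \<DD>) \<longleftrightarrow> c \<le> 0" by auto
qed

section \<open>Classification\<close>

lemma S_H_integer_coefficients_imp_friedman:
  assumes "f \<in> S_H" "integer_coefficients f"
  obtains b c where "friedman_pair b c" "\<And>z. z \<in> \<DD> \<Longrightarrow> f z = quad_recip (of_int b) (of_int c) z"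
proof -
  obtain h g where hg: "normalized_decomp f h g" "sense_preserving_pair h g" and inj: "inj_on f \<DD>"
    using assms(1) by (auto simp: S_H_def)
  obtain h' g' where hg': "normalized_decomp f h' g'"
    and int': "\<And>n. taylor_coeff h' n \<in> \<int>" "\<And>n. taylor_coeff g' n \<in> \<int>"
    using assms(2) by (auto simp: integer_coefficients_def)
  have int: "taylor_coeff h n \<in> \<int>" "taylor_coeff g n \<in> \<int>" for n
    using int'[of n] taylor_coeff_cong[OF normalized_decomp_unique(1)[OF hg(1) hg']]
      taylor_coeff_cong[OF normalized_decomp_unique(2)[OF hg(1) hg']] by simp_all
  have dec: "h holomorphic_on \<DD>" "g holomorphic_on \<DD>" "\<And>z. z \<in> \<DD> \<Longrightarrow> f z = h z + cnj (g z)"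
    "taylor_coeff h 0 = 0" "taylor_coeff h 1 = 1" "taylor_coeff g 0 = 0"
    using hg(1) by (auto simp: normalized_decomp_def harmonic_decomp_def)
  have fh: "f z = h z" if "z \<in> \<DD>" for z
    using dec(3)[OF that] coanalytic_part_zero[OF dec(1,2) hg(2) dec(5,6) int(2) that] by simp
  then have "inj_on h \<DD>" using inj unfolding inj_on_def by metis
  from friedman_theorem[OF dec(1) this dec(4,5) int(1)] fh show thesis using that by metis
qed

text \<open>For a function from Friedman's list, directional convexity is a property \<open>P\<close> of the parameter \<open>c\<close>
  alone. Membership in \<open>\<F>\<close> is that same condition on \<open>c\<close>, because \<open>dir\<close> applies to whichever pair
  \<open>(b, c)\<close> represents \<open>f\<close>.\<close>

lemma CV_iff_one_of_on_disk:
  assumes f: "f \<in> S_H" and bc: "friedman_pair b c"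
    and feq: "\<And>z. z \<in> \<DD> \<Longrightarrow> f z = quad_recip (of_int b) (of_int c) z"
    and dir: "\<And>b c. friedman_pair b c \<Longrightarrow>
      convex_in_direction \<alpha> (quad_recip (of_int b) (of_int c) ` \<DD>) \<longleftrightarrow> P c"
    and F: "\<F> = (\<lambda>(b, c). quad_recip (of_int b) (of_int c)) ` {(b, c). friedman_pair b c \<and> P c}"
  shows "f \<in> CV \<alpha> \<longleftrightarrow> one_of_on_disk f \<F>"
proof -
  have CV: "f \<in> CV \<alpha> \<longleftrightarrow> P c"
    if "friedman_pair b c" "\<And>z. z \<in> \<DD> \<Longrightarrow> f z = quad_recip (of_int b) (of_int c) z" for b c
  proof -
    have "f ` \<DD> = quad_recip (of_int b) (of_int c) ` \<DD>" using that(2) by (intro image_cong) auto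
    then have "convex_in_direction \<alpha> (f ` \<DD>) \<longleftrightarrow> P c" using dir[OF that(1)] by simp
    then show ?thesis
      using f by (auto simp: S_H_def CV_def harmonic_on_disk_def normalized_decomp_def)
  qed
  have one: "one_of_on_disk f \<F> \<longleftrightarrow>
      (\<exists>b c. friedman_pair b c \<and> P c \<and> (\<forall>z\<in>\<DD>. f z = quad_recip (of_int b) (of_int c) z))"
    unfolding one_of_on_disk_def F by fast
  show ?thesis
  proof
    assume "f \<in> CV \<alpha>"
    then have "P c" using CV[OF bc feq] by blast
    then show "one_of_on_disk f \<F>" unfolding one using bc feq by blast
  next
    assume "one_of_on_disk f \<F>"
    then obtain b c where "friedman_pair b c" "P c"
      "\<forall>z\<in>\<DD>. f z = quad_recip (of_int b) (of_int c) z"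
      unfolding one by blast
    then show "f \<in> CV \<alpha>" using CV[of b c] by blast
  qed
qed

theorem theorem2:
  fixes f :: "complex \<Rightarrow> complex"
  assumes "f \<in> S_H \<or> f \<in> S"
    and "integer_coefficients f"
  shows "(f \<in> CV 0 \<longleftrightarrow>
            one_of_on_disk f
              {\<lambda>z. z, \<lambda>z. z / (1 + z), \<lambda>z. z / (1 - z), \<lambda>z. z / (1 + z\<^sup>2),
               \<lambda>z. z / (1 + z)\<^sup>2, \<lambda>z. z / (1 - z)\<^sup>2,
               \<lambda>z. z / (1 + z + z\<^sup>2), \<lambda>z. z / (1 - z + z\<^sup>2)})
       \<and> (f \<in> CV (pi / 2) \<longleftrightarrow>
            one_of_on_disk f
              {\<lambda>z. z, \<lambda>z. z / (1 + z), \<lambda>z. z / (1 - z), \<lambda>z. z / (1 - z\<^sup>2)})"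
    (is "(_ \<longleftrightarrow> one_of_on_disk f ?H) \<and> (_ \<longleftrightarrow> one_of_on_disk f ?V)")
proof -
  have f: "f \<in> S_H" using assms(1) by (auto simp: S_def)
  have recips: "quad_recip 0 0 = (\<lambda>z. z)" "quad_recip 1 0 = (\<lambda>z. z / (1 + z))"
    "quad_recip (- 1) 0 = (\<lambda>z. z / (1 - z))" "quad_recip 0 1 = (\<lambda>z. z / (1 + z\<^sup>2))"
    "quad_recip 2 1 = (\<lambda>z. z / (1 + z)\<^sup>2)" "quad_recip (- 2) 1 = (\<lambda>z. z / (1 - z)\<^sup>2)"
    "quad_recip 1 1 = (\<lambda>z. z / (1 + z + z\<^sup>2))" "quad_recip (- 1) 1 = (\<lambda>z. z / (1 - z + z\<^sup>2))"
    "quad_recip 0 (- 1) = (\<lambda>z. z / (1 - z\<^sup>2))"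
    by (simp_all add: quad_recip_def fun_eq_iff power2_sum power2_diff)
  have H: "?H = (\<lambda>(b, c). quad_recip (of_int b) (of_int c)) ` {(b, c). friedman_pair b c \<and> c \<ge> 0}"
  proof -
    have "friedman_pair b c \<and> c \<ge> 0 \<longleftrightarrow> c = 0 \<and> (b = 0 \<or> b = 1 \<or> b = - 1) \<or>
        c = 1 \<and> (b = 0 \<or> b = 2 \<or> b = - 2 \<or> b = 1 \<or> b = - 1)" for b c
      unfolding friedman_pair_def abs_le_iff by presburger
    then have "{(b, c). friedman_pair b c \<and> c \<ge> 0} =
      {(0, 0), (1, 0), (- 1, 0), (0, 1), (2, 1), (- 2, 1), (1, 1), (- 1, 1)}"
      by (simp add: set_eq_iff) blast
    then show ?thesis by (simp add: recips)
  qed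
  have V: "?V = (\<lambda>(b, c). quad_recip (of_int b) (of_int c)) ` {(b, c). friedman_pair b c \<and> c \<le> 0}"
  proof -
    have "friedman_pair b c \<and> c \<le> 0 \<longleftrightarrow> c = 0 \<and> (b = 0 \<or> b = 1 \<or> b = - 1) \<or> c = - 1 \<and> b = 0" for b c
      unfolding friedman_pair_def abs_le_iff by presburger
    then have "{(b, c). friedman_pair b c \<and> c \<le> 0} = {(0, 0), (1, 0), (- 1, 0), (0, - 1)}"
      by (simp add: set_eq_iff) blast
    then show ?thesis by (simp add: recips)
  qed
  obtain b c where bc: "friedman_pair b c"
    and feq: "\<And>z. z \<in> \<DD> \<Longrightarrow> f z = quad_recip (of_int b) (of_int c) z"
    using S_H_integer_coefficients_imp_friedman[OF f assms(2)] by blast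
  have "f \<in> CV 0 \<longleftrightarrow> one_of_on_disk f ?H"
    by (rule CV_iff_one_of_on_disk[OF f bc feq friedman_convex_in_direction(1) H])
  moreover have "f \<in> CV (pi / 2) \<longleftrightarrow> one_of_on_disk f ?V"
    by (rule CV_iff_one_of_on_disk[OF f bc feq friedman_convex_in_direction(2) V])
  ultimately show ?thesis ..
qed

end
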